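(* $$\lim_{n\to\infty}\frac{|T_n|}{|\mathcal{IS}_n|}=0.$$
   Context: $\mathcal{IS}_n$ is the symmetric inverse semigroup of all partial injective maps from $\{1,\dots,n\}$ to itself (bijections between subsets of $\{1,\dots,n\}$), under composition of partial maps; the empty map, denoted $0$, is its zero element. $T_n\subseteq\mathcal{IS}_n$ is the set of nilpotent elements, i.e. those $\alpha$ with $\alpha^r=0$ for some $r>0$. *)

theory Defs
  imports Complex_Main
begin

definition sym_inv_semigroup :: "nat \<Rightarrow> (nat \<rightharpoonup> nat) set" where
  "sym_inv_semigroup n =
     {\<alpha>. dom \<alpha> \<subseteq> {1..n} \<and> ran \<alpha> \<subseteq> {1..n} \<and> inj_on \<alpha> (dom \<alpha>)}"

(* The zeroth power is the identity map on all of nat, not the identity of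
   sym_inv_semigroup n; the positive powers do not depend on this choice. *)
primrec pmap_power :: "('a \<rightharpoonup> 'a) \<Rightarrow> nat \<Rightarrow> ('a \<rightharpoonup> 'a)" where
  "pmap_power \<alpha> 0 = Some"
| "pmap_power \<alpha> (Suc r) = \<alpha> \<circ>\<^sub>m pmap_power \<alpha> r"

definition nilpotent_elements :: "nat \<Rightarrow> (nat \<rightharpoonup> nat) set" where
  "nilpotent_elements n =
     {\<alpha> \<in> sym_inv_semigroup n. \<exists>r>0. pmap_power \<alpha> r = Map.empty}"

lemma finite_sym_inv_semigroup: "finite (sym_inv_semigroup n)"
proof -
  have "sym_inv_semigroup n \<subseteq>
      (\<Union>A\<in>Pow {1..n}. {\<alpha>. dom \<alpha> = A \<and> ran \<alpha> \<subseteq> {1..n}})"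
    by (auto simp: sym_inv_semigroup_def)
  moreover have "finite (\<Union>A\<in>Pow {1..n}. {\<alpha>. dom \<alpha> = A \<and> ran \<alpha> \<subseteq> {1..n}})"
    by (intro finite_UN_I finite_set_of_finite_maps) (auto intro: finite_subset)
  ultimately show ?thesis by (rule finite_subset)
qed

lemma pmap_power_one: "pmap_power \<alpha> (Suc 0) = \<alpha>"
  by (simp add: map_comp_def)

lemma sym_inv_semigroup_comp:
  assumes "\<alpha> \<in> sym_inv_semigroup n" "\<beta> \<in> sym_inv_semigroup n"
  shows "\<alpha> \<circ>\<^sub>m \<beta> \<in> sym_inv_semigroup n"
proof -
  have "inj_on (\<alpha> \<circ>\<^sub>m \<beta>) (dom (\<alpha> \<circ>\<^sub>m \<beta>))"
  proof (rule inj_onI)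
    fix x y
    assume x: "x \<in> dom (\<alpha> \<circ>\<^sub>m \<beta>)" and y: "y \<in> dom (\<alpha> \<circ>\<^sub>m \<beta>)"
      and eq: "(\<alpha> \<circ>\<^sub>m \<beta>) x = (\<alpha> \<circ>\<^sub>m \<beta>) y"
    from x obtain u c where u: "\<beta> x = Some u" "\<alpha> u = Some c"
      by (auto simp: map_comp_Some_iff)
    from y obtain v d where v: "\<beta> y = Some v" "\<alpha> v = Some d"
      by (auto simp: map_comp_Some_iff)
    have "\<alpha> u = \<alpha> v" using eq u v by (simp add: map_comp_def)
    moreover have "u \<in> dom \<alpha>" "v \<in> dom \<alpha>" using u v by auto
    ultimately have "u = v"
      using assms unfolding sym_inv_semigroup_def inj_on_def by blast
    then have "\<beta> x = \<beta> y" using u v by simp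
    moreover have "x \<in> dom \<beta>" "y \<in> dom \<beta>" using u v by auto
    ultimately show "x = y"
      using assms unfolding sym_inv_semigroup_def inj_on_def by blast
  qed
  moreover have "dom (\<alpha> \<circ>\<^sub>m \<beta>) \<subseteq> dom \<beta>" "ran (\<alpha> \<circ>\<^sub>m \<beta>) \<subseteq> ran \<alpha>"
    by (auto simp: map_comp_Some_iff ran_def)
  ultimately show ?thesis
    using assms unfolding sym_inv_semigroup_def by blast
qed

end

theory Submission
  imports Defs
begin

text \<open>
  View a partial injection as a directed graph on \<open>{1..n}\<close> whose components are cycles and
  chains (isolated points included); it is nilpotent exactly when it has no cycles. Call
  \<open>d = n - k\<close> the defect of an injection of rank \<open>k\<close>: it is the number of chains. The proof
  shows that, among injections of rank \<open>k\<close>, at most a fraction \<open>d / n\<close> is nilpotent, and that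
  the defect is on average at most \<open>sqrt n\<close>.

  Both facts come from growing an injection one edge at a time. Let \<open>a k\<close> and \<open>t k\<close> count the
  injections and the nilpotent injections of rank \<open>k\<close>. An edge \<open>x \<rightarrow> y\<close> can be added to an
  injection of defect \<open>d\<close> when \<open>x\<close> ends a chain and \<open>y\<close> starts one, and this can be undone once
  the added edge is known, so
  \<open>(k + 1) * a (k + 1) = d\<^sup>2 * a k\<close> (\<open>card_injections_of_rank_Suc\<close>).
  To stay nilpotent, \<open>y\<close> must not start the chain that \<open>x\<close> ends, which leaves only \<open>d - 1\<close>
  choices of \<open>y\<close>: \<open>(k + 1) * t (k + 1) \<le> d * (d - 1) * t k\<close>
  (\<open>card_nilpotents_of_rank_Suc\<close>). So each edge multiplies \<open>t / a\<close> by at most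
  \<open>(d - 1) / d\<close>; the product telescopes to \<open>n * t k \<le> (n - k) * a k\<close>
  (\<open>card_nilpotents_of_rank_le\<close>).

  Summed over \<open>k\<close>, the recursion for \<open>a\<close> says that the mean of \<open>d\<^sup>2\<close> over all partial
  injections equals the mean rank and hence is at most \<open>n\<close> (\<open>second_moment_of_defect\<close>). The
  mean defect is therefore at most \<open>sqrt n\<close>, and the proportion of nilpotent elements at most
  \<open>sqrt n / n\<close>.
\<close>

section \<open>Partial injections by rank\<close>

definition injections_of_rank :: "nat \<Rightarrow> nat \<Rightarrow> (nat \<rightharpoonup> nat) set" where
  "injections_of_rank n k = {\<alpha> \<in> sym_inv_semigroup n. card (dom \<alpha>) = k}"

definition nilpotents_of_rank :: "nat \<Rightarrow> nat \<Rightarrow> (nat \<rightharpoonup> nat) set" where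
  "nilpotents_of_rank n k = {\<alpha> \<in> nilpotent_elements n. card (dom \<alpha>) = k}"

lemma finite_injections_of_rank: "finite (injections_of_rank n k)"
  by (simp add: injections_of_rank_def finite_sym_inv_semigroup)

lemma nilpotents_of_rank_subset: "nilpotents_of_rank n k \<subseteq> injections_of_rank n k"
  by (auto simp: nilpotents_of_rank_def injections_of_rank_def nilpotent_elements_def)

lemma finite_nilpotents_of_rank: "finite (nilpotents_of_rank n k)"
  by (rule finite_subset[OF nilpotents_of_rank_subset finite_injections_of_rank])

lemma finite_dom_sym_inv_semigroup: "\<alpha> \<in> sym_inv_semigroup n \<Longrightarrow> finite (dom \<alpha>)"
  by (auto simp: sym_inv_semigroup_def intro: finite_subset)

lemma card_dom_le: "\<alpha> \<in> sym_inv_semigroup n \<Longrightarrow> card (dom \<alpha>) \<le> n"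
  using card_mono[of "{1..n}" "dom \<alpha>"] by (auto simp: sym_inv_semigroup_def)

lemma card_eq_sum_rank:
  assumes "A \<subseteq> sym_inv_semigroup n"
  shows "card A = (\<Sum>k\<le>n. card {\<alpha> \<in> A. card (dom \<alpha>) = k})"
proof -
  have "card A = card (\<Union>k\<in>{..n}. {\<alpha> \<in> A. card (dom \<alpha>) = k})"
    using assms card_dom_le by (intro arg_cong[where f = card]) blast
  also have "\<dots> = (\<Sum>k\<le>n. card {\<alpha> \<in> A. card (dom \<alpha>) = k})"
    using finite_subset[OF assms finite_sym_inv_semigroup]
    by (intro card_UN_disjoint) auto
  finally show ?thesis .
qed

lemma card_free_points:
  assumes "\<gamma> \<in> injections_of_rank n k"
  shows "card ({1..n} - dom \<gamma>) = n - k" "card ({1..n} - ran \<gamma>) = n - k"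
proof -
  have sub: "dom \<gamma> \<subseteq> {1..n}" "ran \<gamma> \<subseteq> {1..n}" and inj: "inj_on \<gamma> (dom \<gamma>)"
    and k: "card (dom \<gamma>) = k"
    using assms by (auto simp: injections_of_rank_def sym_inv_semigroup_def)
  have "inj_on (\<lambda>x. the (\<gamma> x)) (dom \<gamma>)"
    by (rule inj_onI, rule inj_onD[OF inj]) (auto intro: option.expand)
  moreover have "ran \<gamma> = (\<lambda>x. the (\<gamma> x)) ` dom \<gamma>"
    by (force simp: ran_def dom_def)
  ultimately have "card (ran \<gamma>) = k"
    using k by (simp add: card_image)
  then show "card ({1..n} - dom \<gamma>) = n - k" "card ({1..n} - ran \<gamma>) = n - k"
    using sub k by (simp_all add: card_Diff_subset finite_subset[OF _ finite_atLeastAtMost])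
qed

section \<open>Adding and deleting an edge\<close>

lemma map_upd_mem_sym_inv_semigroup:
  assumes "\<gamma> \<in> sym_inv_semigroup n" "x \<in> {1..n} - dom \<gamma>" "y \<in> {1..n} - ran \<gamma>"
  shows "\<gamma>(x \<mapsto> y) \<in> sym_inv_semigroup n"
  using assms unfolding sym_inv_semigroup_def inj_on_def
  by (auto simp: ran_def dom_def split: if_splits)

lemma map_del_mem_sym_inv_semigroup:
  assumes "\<alpha> \<in> sym_inv_semigroup n" "\<alpha> x = Some y"
  shows "\<alpha>(x := None) \<in> sym_inv_semigroup n" "y \<in> {1..n} - ran (\<alpha>(x := None))"
  using assms unfolding sym_inv_semigroup_def inj_on_def
  by (auto simp: ran_def dom_def split: if_splits)

text \<open>
  The inverse deletes the marked edge. Marking the source \<open>x\<close> of the new edge suffices, since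
  the target is then the image of \<open>x\<close>.
\<close>

lemma bij_betw_add_edge:
  "bij_betw (\<lambda>(\<gamma>, x, y). (\<gamma>(x \<mapsto> y), x))
     (SIGMA \<gamma>:injections_of_rank n k. ({1..n} - dom \<gamma>) \<times> ({1..n} - ran \<gamma>))
     (SIGMA \<alpha>:injections_of_rank n (Suc k). dom \<alpha>)"
proof (rule bij_betw_byWitness[where f' = "\<lambda>(\<alpha>, x). (\<alpha>(x := None), x, the (\<alpha> x))"], goal_cases)
  case 3
  show ?case
    by (auto simp: injections_of_rank_def card_insert_if finite_dom_sym_inv_semigroup
        intro!: map_upd_mem_sym_inv_semigroup)
next
  case 4
  show ?case
  proof (clarsimp simp: injections_of_rank_def)
    fix \<alpha> x y
    assume \<alpha>: "\<alpha> \<in> sym_inv_semigroup n" "card (dom \<alpha>) = Suc k" "\<alpha> x = Some y"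
    have "x \<in> {1..n}"
      using \<alpha> by (auto simp: sym_inv_semigroup_def)
    moreover have "card (dom \<alpha> - {x}) = k"
      using \<alpha> by (simp add: card_Diff_singleton domI)
    ultimately show "\<alpha>(x := None) \<in> sym_inv_semigroup n \<and> card (dom \<alpha> - {x}) = k \<and>
        Suc 0 \<le> x \<and> x \<le> n \<and> Suc 0 \<le> y \<and> y \<le> n \<and> y \<notin> ran (\<alpha>(x := None))"
      using map_del_mem_sym_inv_semigroup[OF \<alpha>(1,3)] by auto
  qed
qed (auto simp: fun_eq_iff)

text \<open>Both sides count the partial injections of rank \<open>k + 1\<close> with one marked edge.\<close>

lemma card_injections_of_rank_Suc:
  "Suc k * card (injections_of_rank n (Suc k)) = (n - k)\<^sup>2 * card (injections_of_rank n k)"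
proof -
  have "(n - k)\<^sup>2 * card (injections_of_rank n k)
      = card (SIGMA \<gamma>:injections_of_rank n k. ({1..n} - dom \<gamma>) \<times> ({1..n} - ran \<gamma>))"
    by (simp add: finite_injections_of_rank card_cartesian_product card_free_points
        power2_eq_square del: One_nat_def)
  also have "\<dots> = card (SIGMA \<alpha>:injections_of_rank n (Suc k). dom \<alpha>)"
    by (rule bij_betw_same_card[OF bij_betw_add_edge])
  also have "\<dots> = (\<Sum>\<alpha>\<in>injections_of_rank n (Suc k). card (dom \<alpha>))"
    using finite_injections_of_rank finite_dom_sym_inv_semigroup
    by (intro card_SigmaI) (auto simp: injections_of_rank_def)
  also have "\<dots> = Suc k * card (injections_of_rank n (Suc k))"
    by (simp add: injections_of_rank_def)
  finally show ?thesis by simp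
qed

section \<open>Nilpotent partial injections\<close>

text \<open>
  Passing to graphs turns powers of partial maps into relational powers, so that nilpotency can
  be exploited through acyclicity and well-foundedness of relations.
\<close>

lemma graph_pmap_power: "Map.graph (pmap_power \<alpha> r) = Map.graph \<alpha> ^^ r"
proof (induction r)
  case 0
  show ?case
    by (auto simp: Map.graph_def)
qed simp

lemma mem_nilpotent_elements_iff:
  "\<alpha> \<in> nilpotent_elements n \<longleftrightarrow>
     \<alpha> \<in> sym_inv_semigroup n \<and> (\<exists>r>0. Map.graph \<alpha> ^^ r = {})"
proof -
  have "\<beta> = Map.empty \<longleftrightarrow> Map.graph \<beta> = {}" for \<beta> :: "nat \<rightharpoonup> nat"
    by (auto simp: Map.graph_def fun_eq_iff)
  then show ?thesis
    by (simp add: nilpotent_elements_def graph_pmap_power)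
qed

text \<open>Going round a cycle repeatedly gives arbitrarily long walks.\<close>

lemma acyclic_if_relpow_empty:
  assumes "R ^^ r = {}"
  shows "acyclic R"
  unfolding acyclic_def
proof (intro allI notI)
  fix y
  assume "(y, y) \<in> R\<^sup>+"
  then obtain j where "j > 0" and j: "(y, y) \<in> R ^^ j"
    by (auto simp: trancl_power)
  have "(y, y) \<in> R ^^ (m * j)" for m
    using j by (induction m) (auto simp: relpow_add)
  moreover have "R ^^ (r * j) = {}"
    using \<open>j > 0\<close> assms by (cases j) (auto simp: relpow_add)
  ultimately show False by auto
qed

lemma acyclic_graph_nilpotent: "\<alpha> \<in> nilpotent_elements n \<Longrightarrow> acyclic (Map.graph \<alpha>)"
  using acyclic_if_relpow_empty by (auto simp: mem_nilpotent_elements_iff)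

lemma map_del_mem_nilpotent_elements:
  assumes "\<alpha> \<in> nilpotent_elements n" "\<alpha>(x := None) \<in> sym_inv_semigroup n"
  shows "\<alpha>(x := None) \<in> nilpotent_elements n"
proof -
  obtain r where r: "r > 0" "Map.graph \<alpha> ^^ r = {}"
    using assms(1) by (auto simp: mem_nilpotent_elements_iff)
  have sub: "Map.graph (\<alpha>(x := None)) \<subseteq> Map.graph \<alpha>"
    by (auto simp: Map.graph_def split: if_splits)
  have "Map.graph (\<alpha>(x := None)) ^^ r \<subseteq> Map.graph \<alpha> ^^ r"
    by (induction r) (simp, simp only: relpow.simps relcomp_mono[OF _ sub])
  then show ?thesis
    using assms(2) r by (auto simp: mem_nilpotent_elements_iff)
qed

text \<open>
  Walking backwards from \<open>x\<close> must stop, because a finite acyclic graph is well-founded; it can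
  only stop at a point outside the range. This start of the chain through \<open>x\<close> is the one free
  target to which \<open>x\<close> cannot be joined.
\<close>

lemma chain_start_exists:
  assumes "\<gamma> \<in> nilpotent_elements n" "x \<in> {1..n}"
  obtains y where "y \<in> {1..n} - ran \<gamma>" "(y, x) \<in> (Map.graph \<gamma>)\<^sup>*"
proof -
  have \<gamma>: "\<gamma> \<in> sym_inv_semigroup n"
    using assms(1) by (simp add: nilpotent_elements_def)
  then have sub: "dom \<gamma> \<subseteq> {1..n}"
    by (simp add: sym_inv_semigroup_def)
  have "Map.graph \<gamma> = (\<lambda>a. (a, the (\<gamma> a))) ` dom \<gamma>"
    by (force simp: Map.graph_def)
  then have "wf (Map.graph \<gamma>)"
    using finite_dom_sym_inv_semigroup[OF \<gamma>] acyclic_graph_nilpotent[OF assms(1)]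
    by (simp add: finite_acyclic_wf)
  then obtain y where y: "(y, x) \<in> (Map.graph \<gamma>)\<^sup>*"
    and min: "\<And>z. (z, y) \<in> Map.graph \<gamma> \<Longrightarrow> (z, x) \<notin> (Map.graph \<gamma>)\<^sup>*"
    using wfE_min[of "Map.graph \<gamma>" x "{y. (y, x) \<in> (Map.graph \<gamma>)\<^sup>*}"] by auto
  have "y \<notin> ran \<gamma>"
    using y min by (auto simp: ran_def Map.graph_def intro: converse_rtrancl_into_rtrancl)
  moreover have "y \<in> {1..n}"
    using y
  proof (cases rule: converse_rtranclE)
    case (step z)
    then show ?thesis
      using sub by (auto simp: Map.graph_def)
  qed (use assms(2) in simp)
  ultimately show thesis
    using that y by blast
qed

lemma closing_chain_not_nilpotent:
  assumes "(y, x) \<in> (Map.graph \<gamma>)\<^sup>*" "\<gamma> x = None"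
  shows "\<gamma>(x \<mapsto> y) \<notin> nilpotent_elements n"
proof
  assume "\<gamma>(x \<mapsto> y) \<in> nilpotent_elements n"
  then have "acyclic (insert (x, y) (Map.graph \<gamma>))"
    using acyclic_graph_nilpotent[of "\<gamma>(x \<mapsto> y)"] assms(2) by (simp add: fun_upd_idem)
  then show False
    using assms(1) by (simp add: acyclic_insert)
qed

text \<open>
  The nilpotent elements of rank \<open>k + 1\<close> with one marked edge are counted on the left. Deleting
  the edge \<open>x \<rightarrow> y\<close> leaves a nilpotent element of rank \<open>k\<close>, in which \<open>x\<close> is one of \<open>n - k\<close> free
  sources, while \<open>y\<close> is a free target other than the start of the chain of \<open>x\<close>.
\<close>

lemma card_nilpotents_of_rank_Suc:
  "Suc k * card (nilpotents_of_rank n (Suc k))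
     \<le> (n - k) * (n - Suc k) * card (nilpotents_of_rank n k)"
proof -
  let ?T = "\<lambda>k. nilpotents_of_rank n k" and ?I = "\<lambda>k. injections_of_rank n k"
  let ?del = "\<lambda>(\<alpha>, x). (\<alpha>(x := None), x, the (\<alpha> x) :: nat)"
  let ?Y = "\<lambda>\<gamma> x. {y \<in> {1..n} - ran \<gamma>. \<gamma>(x \<mapsto> y) \<in> nilpotent_elements n}"
  let ?Q = "SIGMA \<gamma>:?T k. SIGMA x:{1..n} - dom \<gamma>. ?Y \<gamma> x"
  have Y: "card (?Y \<gamma> x) \<le> n - Suc k"
    if \<gamma>: "\<gamma> \<in> ?T k" and x: "x \<in> {1..n} - dom \<gamma>" for \<gamma> x
  proof -
    obtain y where y: "y \<in> {1..n} - ran \<gamma>" "(y, x) \<in> (Map.graph \<gamma>)\<^sup>*"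
      using chain_start_exists[of \<gamma> n x] \<gamma> x by (auto simp: nilpotents_of_rank_def)
    have "?Y \<gamma> x \<subseteq> ({1..n} - ran \<gamma>) - {y}"
      using closing_chain_not_nilpotent[OF y(2)] x by auto
    then have "card (?Y \<gamma> x) \<le> card (({1..n} - ran \<gamma>) - {y})"
      by (intro card_mono) auto
    also have "\<dots> = n - Suc k"
      using y(1) \<gamma> nilpotents_of_rank_subset[of n k] card_free_points(2)[of \<gamma> n k]
      by (subst card_Diff_singleton) auto
    finally show ?thesis .
  qed
  have "Suc k * card (?T (Suc k)) = (\<Sum>\<alpha>\<in>?T (Suc k). card (dom \<alpha>))"
    by (simp add: nilpotents_of_rank_def)
  also have "\<dots> = card (SIGMA \<alpha>:?T (Suc k). dom \<alpha>)"
    using finite_nilpotents_of_rank finite_dom_sym_inv_semigroup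
    by (intro card_SigmaI[symmetric]) (auto simp: nilpotents_of_rank_def nilpotent_elements_def)
  also have "\<dots> \<le> card ?Q"
  proof (rule card_inj_on_le[where f = ?del])
    show "inj_on ?del (SIGMA \<alpha>:?T (Suc k). dom \<alpha>)"
      by (auto simp: inj_on_def fun_eq_iff) (metis option.collapse option.distinct(1))
    show "?del ` (SIGMA \<alpha>:?T (Suc k). dom \<alpha>) \<subseteq> ?Q"
    proof clarsimp
      fix \<alpha> x y
      assume \<alpha>: "\<alpha> \<in> ?T (Suc k)" "\<alpha> x = Some y"
      then have mem: "\<alpha> \<in> nilpotent_elements n" "\<alpha> \<in> sym_inv_semigroup n"
        and card: "card (dom \<alpha>) = Suc k"
        by (auto simp: nilpotents_of_rank_def nilpotent_elements_def)
      note del = map_del_mem_sym_inv_semigroup[OF mem(2) \<alpha>(2)]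
      have "x \<in> {1..n}"
        using mem(2) \<alpha>(2) by (auto simp: sym_inv_semigroup_def)
      moreover have "\<alpha>(x := None) \<in> ?T k"
        using map_del_mem_nilpotent_elements[OF mem(1) del(1)] \<alpha>(2) card
        by (simp add: nilpotents_of_rank_def card_Diff_singleton domI)
      ultimately show "\<alpha>(x := None) \<in> ?T k \<and> Suc 0 \<le> x \<and> x \<le> n \<and> Suc 0 \<le> y \<and> y \<le> n \<and>
          y \<notin> ran (\<alpha>(x := None)) \<and> \<alpha>(x \<mapsto> y) \<in> nilpotent_elements n"
        using del(2) mem(1) \<alpha>(2) by (simp add: fun_upd_idem)
    qed
    show "finite ?Q"
      using finite_nilpotents_of_rank by (intro finite_SigmaI) auto
  qed
  also have "\<dots> = (\<Sum>\<gamma>\<in>?T k. \<Sum>x\<in>{1..n} - dom \<gamma>. card (?Y \<gamma> x))"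
    using finite_nilpotents_of_rank by simp
  also have "\<dots> \<le> (\<Sum>\<gamma>\<in>?T k. \<Sum>x\<in>{1..n} - dom \<gamma>. n - Suc k)"
    using Y by (intro sum_mono) 
  also have "\<dots> = (\<Sum>\<gamma>\<in>?T k. (n - k) * (n - Suc k))"
    using nilpotents_of_rank_subset[of n k] card_free_points(1)[of _ n k]
    by (intro sum.cong) auto
  finally show ?thesis
    by (simp add: mult_ac)
qed

text \<open>
  With \<open>d = n - k\<close>, passing from rank \<open>k\<close> to \<open>k + 1\<close> multiplies the bound \<open>d / n\<close> on the
  nilpotent fraction by \<open>d * (d - 1) / d\<^sup>2\<close>, which gives \<open>(d - 1) / n\<close>.
\<close>

lemma card_nilpotents_of_rank_le:
  "n * card (nilpotents_of_rank n k) \<le> (n - k) * card (injections_of_rank n k)"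
proof (induction k)
  case 0
  then show ?case
    using card_mono[OF finite_injections_of_rank nilpotents_of_rank_subset] by simp
next
  case (Suc k)
  have "Suc k * (n * card (nilpotents_of_rank n (Suc k)))
      \<le> n * ((n - k) * (n - Suc k) * card (nilpotents_of_rank n k))"
    using mult_le_mono2[OF card_nilpotents_of_rank_Suc, of n k n] by (simp add: algebra_simps)
  also have "\<dots> = (n - k) * (n - Suc k) * (n * card (nilpotents_of_rank n k))"
    by (simp only: mult_ac)
  also have "\<dots> \<le> (n - k) * (n - Suc k) * ((n - k) * card (injections_of_rank n k))"
    by (rule mult_le_mono2[OF Suc])
  also have "\<dots> = (n - Suc k) * ((n - k)\<^sup>2 * card (injections_of_rank n k))"
    by (simp only: power2_eq_square mult_ac)
  also have "\<dots> = Suc k * ((n - Suc k) * card (injections_of_rank n (Suc k)))"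
    by (subst card_injections_of_rank_Suc[symmetric]) (simp only: mult_ac)
  finally show ?case
    by (simp only: mult_le_cancel1)
qed

section \<open>The defect of a random partial injection\<close>

lemma sum_card_injections_of_rank:
  "(\<Sum>k\<le>n. card (injections_of_rank n k)) = card (sym_inv_semigroup n)"
  unfolding injections_of_rank_def by (rule card_eq_sum_rank[symmetric]) simp

text \<open>
  Replacing each term by \<open>(k + 1)\<close> times the number of injections of rank \<open>k + 1\<close> turns the sum
  of the squared defects into the sum of the ranks, and no rank exceeds \<open>n\<close>.
\<close>

lemma second_moment_of_defect:
  "(\<Sum>k\<le>n. (n - k)\<^sup>2 * card (injections_of_rank n k)) \<le> n * card (sym_inv_semigroup n)"
proof -
  \<comment> \<open>The term \<open>k = n\<close> has defect zero and drops out.\<close>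
  have "(\<Sum>k\<le>n. (n - k)\<^sup>2 * card (injections_of_rank n k))
      = (\<Sum>k<n. Suc k * card (injections_of_rank n (Suc k)))"
    by (simp add: card_injections_of_rank_Suc flip: lessThan_Suc_atMost del: mult_Suc)
  also have "\<dots> \<le> (\<Sum>k<n. n * card (injections_of_rank n (Suc k)))"
    by (intro sum_mono mult_le_mono1) simp
  also have "\<dots> \<le> n * (\<Sum>k\<le>n. card (injections_of_rank n k))"
    by (simp add: sum.lessThan_Suc_shift flip: lessThan_Suc_atMost sum_distrib_left
        del: sum.lessThan_Suc)
  finally show ?thesis
    by (simp add: sum_card_injections_of_rank)
qed

text \<open>
  The first moment of the defect bounds the number of nilpotent elements, and it is controlled
  by the second moment through \<open>2 * sqrt n * d \<le> d\<^sup>2 + n\<close>. Equality holds for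
  \<open>d = sqrt n\<close>, the bound that the second moment gives for the root mean square defect.
\<close>

lemma sqrt_mult_card_nilpotent_elements_le:
  "sqrt n * card (nilpotent_elements n) \<le> card (sym_inv_semigroup n)"
proof (cases "n = 0")
  case False
  let ?a = "\<lambda>k. real (card (injections_of_rank n k))"
  let ?d = "\<lambda>k. real (n - k)"
  have "nilpotent_elements n \<subseteq> sym_inv_semigroup n"
    by (auto simp: nilpotent_elements_def)
  then have "n * card (nilpotent_elements n) = (\<Sum>k\<le>n. n * card (nilpotents_of_rank n k))"
    by (simp add: card_eq_sum_rank nilpotents_of_rank_def sum_distrib_left)
  also have "\<dots> \<le> (\<Sum>k\<le>n. (n - k) * card (injections_of_rank n k))"
    by (intro sum_mono card_nilpotents_of_rank_le)
  finally have first: "real n * card (nilpotent_elements n) \<le> (\<Sum>k\<le>n. ?d k * ?a k)"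
    by (simp del: of_nat_diff flip: of_nat_mult of_nat_sum)
  have second: "(\<Sum>k\<le>n. (?d k)\<^sup>2 * ?a k) \<le> n * real (card (sym_inv_semigroup n))"
    using second_moment_of_defect[of n] by (simp del: of_nat_diff flip: of_nat_mult of_nat_sum of_nat_power)
  have "2 * sqrt n * (real n * card (nilpotent_elements n)) \<le> (\<Sum>k\<le>n. 2 * sqrt n * ?d k * ?a k)"
    using mult_left_mono[OF first, of "2 * sqrt n"] by (simp add: sum_distrib_left mult.assoc)
  also have "\<dots> \<le> (\<Sum>k\<le>n. ((?d k)\<^sup>2 + n) * ?a k)"
  proof (intro sum_mono mult_right_mono)
    fix k
    show "2 * sqrt n * ?d k \<le> (?d k)\<^sup>2 + n"
      using sum_squares_bound[of "?d k" "sqrt n"] by (simp add: mult_ac)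
  qed simp
  also have "\<dots> = (\<Sum>k\<le>n. (?d k)\<^sup>2 * ?a k) + n * (\<Sum>k\<le>n. ?a k)"
    by (simp add: distrib_right sum.distrib sum_distrib_left)
  also have "\<dots> \<le> n * (2 * real (card (sym_inv_semigroup n)))"
    using second sum_card_injections_of_rank[of n] by (simp flip: of_nat_sum)
  finally show ?thesis
    using False by simp
qed simp

theorem theorem9:
  shows "(\<lambda>n. real (card (nilpotent_elements n)) / real (card (sym_inv_semigroup n)))
           \<longlonglongrightarrow> 0"
proof (rule tendsto_sandwich[OF always_eventually _ tendsto_const])
  show "(\<lambda>n. 1 / sqrt (real n)) \<longlonglongrightarrow> 0"
    by (intro tendsto_divide_0[OF tendsto_const] filterlim_at_top_imp_at_infinity
        filterlim_compose[OF sqrt_at_top filterlim_real_sequentially])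
  show "\<forall>\<^sub>F n in sequentially. real (card (nilpotent_elements n)) / real (card (sym_inv_semigroup n))
      \<le> 1 / sqrt (real n)"
    using eventually_gt_at_top[of 0]
  proof eventually_elim
    case (elim n)
    have "Map.empty \<in> sym_inv_semigroup n"
      by (simp add: sym_inv_semigroup_def)
    then have "card (sym_inv_semigroup n) > 0"
      using finite_sym_inv_semigroup by (auto simp: card_gt_0_iff)
    then show ?case
      using sqrt_mult_card_nilpotent_elements_le[of n] elim by (simp add: field_simps)
  qed
qed auto

end
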